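(* If $Q$ is a balanced quiver, then $\mathrm{mut}^k_m(Q)$ is balanced for any vertex $m$ of $Q$ and any integer $k$. Furthermore, for the functions $\mathrm{mut}^k:(Q,m)\mapsto(\mathrm{mut}^k_m(Q),m)$ on the set of pairs $(Q,m)$ with $Q$ a balanced quiver and $m$ a vertex of $Q$, we have $\mathrm{mut}^0\circ\mathrm{mut}^0=\mathrm{id}$ and, for all $s,t\in\mathbb{Z}$, $$\mathrm{mut}^t\circ\mathrm{mut}^s=\mathrm{mut}^0\circ\mathrm{mut}^{s-t}.$$ In particular, the functions $\mathrm{mut}^k$ $(k\in\mathbb{Z})$ are self-inverse. Thus, finite compositions of these functions form a group, which is generated by $\{\mathrm{mut}^0,\mathrm{mut}^1\}$.
   Context: All quivers have finitely many vertices and finitely many arrows between any two vertices. A decorated quiver is a quiver with no self-loops or $2$-cycles each of whose vertices $v$ carries a label $(w_v,\ell_v)\in\mathbb{Z}^2$. For vertices $x,y$, $\mathrm{a}(x,y)$ is the signed number of arrows between them: positive if arrows point from $x$ to $y$, negative if from $y$ to $x$, zero if there are none. $\mathrm{out}(m)$ is the set of vertices receiving an arrow from $m$, and $\mathrm{in}(m)$ is the set of vertices from which $m$ receives an arrow. A decorated quiver $Q$ is balanced if for every vertex $m$, $\sum_{h\in\mathrm{out}(m)}w_h\,\mathrm{a}(m,h)=\sum_{t\in\mathrm{in}(m)}w_t\,\mathrm{a}(t,m)$. The common value is the diameter $D(m)$. For a balanced quiver $Q$, a vertex $m$ with label $(w,\ell)$ and an integer $k$, the quiver $\mathrm{mut}_m^k(Q)$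 is obtained as follows: (a) reverse all arrows incident at $m$; (b) for every subquiver $t\to m\to h$ of $Q$ (counted with multiplicity of arrows), introduce $k$ arrows $t\to h$ (for $k<0$, this means $|k|$ arrows $h\to t$); (c) cancel all $2$-cycles. A vertex $v\neq m$ keeps its label, and $m$ receives the label $(kD(m)-w,\,D(m)-\ell)$, where $D(m)$ is computed in $Q$. *)

theory Defs
  imports Main "HOL-Library.FuncSet" "HOL-Algebra.Generated_Groups"
begin

text \<open>
  A quiver is given by its vertex set and its arrow multiplicities: \<open>arr Q x y\<close> is the number of
  arrows from \<open>x\<close> to \<open>y\<close>. Two quivers with the same vertices are thus identified when they differ
  only by the names of their arrows; cancelling 2-cycles is not well defined on named arrows.
\<close>

record 'v dquiver =
  verts :: "'v set"
  arr :: "'v \<Rightarrow> 'v \<Rightarrow> nat"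
  label :: "'v \<Rightarrow> int \<times> int"

text \<open>
  The conditions on \<open>arr\<close> and \<open>label\<close> outside \<open>verts Q\<close> make equality of records coincide with
  equality of decorated quivers.
\<close>

definition decorated_quiver :: "'v dquiver \<Rightarrow> bool" where
  "decorated_quiver Q \<longleftrightarrow>
     finite (verts Q) \<and>
     (\<forall>x y. arr Q x y \<noteq> 0 \<longrightarrow> x \<in> verts Q \<and> y \<in> verts Q) \<and>
     label Q \<in> extensional (verts Q) \<and>
     (\<forall>x. arr Q x x = 0) \<and>
     (\<forall>x y. arr Q x y = 0 \<or> arr Q y x = 0)"

definition wlab :: "'v dquiver \<Rightarrow> 'v \<Rightarrow> int" where
  "wlab Q v = fst (label Q v)"

definition llab :: "'v dquiver \<Rightarrow> 'v \<Rightarrow> int" where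
  "llab Q v = snd (label Q v)"

text \<open>In a decorated quiver at most one of the two terms below is nonzero.\<close>

definition sarr :: "'v dquiver \<Rightarrow> 'v \<Rightarrow> 'v \<Rightarrow> int" where
  "sarr Q x y = int (arr Q x y) - int (arr Q y x)"

definition out_verts :: "'v dquiver \<Rightarrow> 'v \<Rightarrow> 'v set" where
  "out_verts Q m = {h \<in> verts Q. arr Q m h > 0}"

definition in_verts :: "'v dquiver \<Rightarrow> 'v \<Rightarrow> 'v set" where
  "in_verts Q m = {t \<in> verts Q. arr Q t m > 0}"

definition balanced :: "'v dquiver \<Rightarrow> bool" where
  "balanced Q \<longleftrightarrow> decorated_quiver Q \<and>
     (\<forall>m \<in> verts Q.
        (\<Sum>h\<in>out_verts Q m. wlab Q h * sarr Q m h) = (\<Sum>t\<in>in_verts Q m. wlab Q t * sarr Q t m))"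

definition diameter :: "'v dquiver \<Rightarrow> 'v \<Rightarrow> int" where
  "diameter Q m = (\<Sum>h\<in>out_verts Q m. wlab Q h * sarr Q m h)"

definition reverse_at :: "'v \<Rightarrow> ('v \<Rightarrow> 'v \<Rightarrow> nat) \<Rightarrow> 'v \<Rightarrow> 'v \<Rightarrow> nat" where
  "reverse_at m n x y = (if x = m \<or> y = m then n y x else n x y)"

text \<open>
  The number of new arrows \<open>x \<rightarrow> y\<close> in step (b): for \<open>k \<ge> 0\<close> they come from the paths
  \<open>x \<rightarrow> m \<rightarrow> y\<close> and the second summand vanishes; for \<open>k < 0\<close> they come from the paths
  \<open>y \<rightarrow> m \<rightarrow> x\<close> and the first summand vanishes. Here \<open>n\<close> counts the arrows of the original quiver.
\<close>

definition path_arrows :: "'v \<Rightarrow> int \<Rightarrow> ('v \<Rightarrow> 'v \<Rightarrow> nat) \<Rightarrow> 'v \<Rightarrow> 'v \<Rightarrow> nat" where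
  "path_arrows m k n x y = nat k * (n x m * n m y) + nat (- k) * (n y m * n m x)"

text \<open>The subtraction is truncated: \<open>min (n x y) (n y x)\<close> pairs of opposite arrows are removed.\<close>

definition cancel_2cycles :: "('v \<Rightarrow> 'v \<Rightarrow> nat) \<Rightarrow> 'v \<Rightarrow> 'v \<Rightarrow> nat" where
  "cancel_2cycles n x y = n x y - n y x"

definition mutate :: "int \<Rightarrow> 'v \<Rightarrow> 'v dquiver \<Rightarrow> 'v dquiver" where
  "mutate k m Q =
     \<lparr> verts = verts Q,
       arr = cancel_2cycles (\<lambda>x y. reverse_at m (arr Q) x y + path_arrows m k (arr Q) x y),
       label = (label Q)(m := (k * diameter Q m - wlab Q m, diameter Q m - llab Q m)) \<rparr>"

definition balanced_pairs :: "('v dquiver \<times> 'v) set" where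
  "balanced_pairs = {(Q, m). balanced Q \<and> m \<in> verts Q}"

definition mut :: "int \<Rightarrow> 'v dquiver \<times> 'v \<Rightarrow> 'v dquiver \<times> 'v" where
  "mut k = (\<lambda>(Q, m) \<in> balanced_pairs. (mutate k m Q, m))"

text \<open>
  Nonempty finite compositions; that the identity is among them is part of what makes them a group.
\<close>

inductive_set mut_compositions :: "('v dquiver \<times> 'v \<Rightarrow> 'v dquiver \<times> 'v) set" where
  single: "mut k \<in> mut_compositions"
| comp: "f \<in> mut_compositions \<Longrightarrow> compose balanced_pairs (mut k) f \<in> mut_compositions"

definition mut_group :: "('v dquiver \<times> 'v \<Rightarrow> 'v dquiver \<times> 'v) monoid" where
  "mut_group = \<lparr> carrier = mut_compositions, mult = compose balanced_pairs,
                 one = (\<lambda>p\<in>balanced_pairs. p) \<rparr>"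

end

theory Submission
  imports Defs
begin

text \<open>
  On signed arrow counts \<open>a\<close>, mutation at \<open>m\<close> negates \<open>a(m, -)\<close> and adds
  \<open>k (n(x,m) n(m,y) - n(y,m) n(m,x))\<close> to \<open>a(x,y)\<close> for \<open>x, y \<noteq> m\<close>. Balance at \<open>x\<close> says
  \<open>\<Sum>\<^sub>v w\<^sub>v a(x,v) = 0\<close>; the new arrows change this sum by \<open>k D(m) a(x,m)\<close>, which is what the new
  weight \<open>k D(m) - w\<close> compensates. Neither \<open>D(m)\<close> nor, up to sign, the correction term is changed
  by mutation at \<open>m\<close>, so both \<open>mut\<^sup>t \<circ> mut\<^sup>s\<close> and \<open>mut\<^sup>0 \<circ> mut\<^bsup>s-t\<^esup>\<close> add \<open>s - t\<close> times that term.
\<close>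

section \<open>Signed arrow counts and balance\<close>

lemma decorated_quiver_eqI:
  assumes "decorated_quiver Q" "decorated_quiver Q'" "verts Q = verts Q'" "label Q = label Q'"
    and sarr: "\<And>x y. sarr Q x y = sarr Q' x y"
  shows "Q = (Q' :: 'v dquiver)"
proof -
  \<comment> \<open>Without 2-cycles, one of the two opposite counts is zero, so each count is the
    positive part of the signed one.\<close>
  have arr_nat: "arr R x y = nat (sarr R x y)" if "decorated_quiver R" for R :: "'v dquiver" and x y
    using that unfolding decorated_quiver_def sarr_def
    by (metis diff_0_right diff_le_0_iff_le nat_0_iff nat_int of_nat_0 of_nat_0_le_iff)
  have "arr Q = arr Q'"
    using assms by (intro ext) (simp add: arr_nat)
  with assms show ?thesis by simp
qed

text \<open>Other vertices contribute zero, and an out-neighbour of \<open>m\<close> sends no arrow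
  back. The sum now ranges over \<open>verts Q\<close>, a set that mutation leaves fixed.\<close>

lemma sum_out_verts:
  assumes "decorated_quiver Q"
  shows "(\<Sum>h\<in>out_verts Q m. wlab Q h * sarr Q m h) = (\<Sum>h\<in>verts Q. wlab Q h * int (arr Q m h))"
proof (rule sum.mono_neutral_cong_left)
  show "finite (verts Q)" "out_verts Q m \<subseteq> verts Q"
    using assms by (auto simp: decorated_quiver_def out_verts_def)
  show "\<forall>i\<in>verts Q - out_verts Q m. wlab Q i * int (arr Q m i) = 0"
    by (auto simp: out_verts_def)
  fix h assume "h \<in> out_verts Q m"
  then have "arr Q h m = 0"
    using assms unfolding decorated_quiver_def out_verts_def by (metis (mono_tags, lifting) less_irrefl mem_Collect_eq)
  then show "wlab Q h * sarr Q m h = wlab Q h * int (arr Q m h)"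
    by (simp add: sarr_def)
qed

lemma sum_in_verts:
  assumes "decorated_quiver Q"
  shows "(\<Sum>t\<in>in_verts Q m. wlab Q t * sarr Q t m) = (\<Sum>t\<in>verts Q. wlab Q t * int (arr Q t m))"
proof (rule sum.mono_neutral_cong_left)
  show "finite (verts Q)" "in_verts Q m \<subseteq> verts Q"
    using assms by (auto simp: decorated_quiver_def in_verts_def)
  show "\<forall>i\<in>verts Q - in_verts Q m. wlab Q i * int (arr Q i m) = 0"
    by (auto simp: in_verts_def)
  fix t assume "t \<in> in_verts Q m"
  then have "arr Q m t = 0"
    using assms unfolding decorated_quiver_def in_verts_def by (metis (mono_tags, lifting) less_irrefl mem_Collect_eq)
  then show "wlab Q t * sarr Q t m = wlab Q t * int (arr Q t m)"
    by (simp add: sarr_def)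
qed

lemma diameter_out:
  assumes "decorated_quiver Q"
  shows "diameter Q m = (\<Sum>h\<in>verts Q. wlab Q h * int (arr Q m h))"
  unfolding diameter_def by (rule sum_out_verts[OF assms])

lemma diameter_in:
  assumes "balanced Q" "m \<in> verts Q"
  shows "diameter Q m = (\<Sum>t\<in>verts Q. wlab Q t * int (arr Q t m))"
  using assms sum_in_verts[of Q m] by (simp add: balanced_def diameter_def)

text \<open>The difference of the two sides of the balance condition is a single sum linear in
  \<open>sarr\<close>.\<close>

lemma balanced_iff_sum_sarr:
  "balanced Q \<longleftrightarrow>
     decorated_quiver Q \<and> (\<forall>m\<in>verts Q. (\<Sum>v\<in>verts Q. wlab Q v * sarr Q m v) = 0)"
proof -
  have "(\<Sum>v\<in>verts Q. wlab Q v * sarr Q m v) =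
      (\<Sum>v\<in>verts Q. wlab Q v * int (arr Q m v)) - (\<Sum>v\<in>verts Q. wlab Q v * int (arr Q v m))" for m
    by (simp add: sarr_def right_diff_distrib sum_subtractf)
  then show ?thesis
    unfolding balanced_def by (auto simp: sum_out_verts sum_in_verts)
qed

section \<open>The effect of one mutation\<close>

lemma sarr_mutate:
  assumes "decorated_quiver Q"
  shows "sarr (mutate k m Q) x y =
    (if x = m \<or> y = m then - sarr Q x y
     else sarr Q x y + k * (int (arr Q x m) * int (arr Q m y) - int (arr Q y m) * int (arr Q m x)))"
proof -
  \<comment> \<open>Cancellation removes equally many arrows in both directions, so signed counts do
    not see it.\<close>
  have cancel: "int (cancel_2cycles n x y) - int (cancel_2cycles n y x) = int (n x y) - int (n y x)"
    for n :: "'a \<Rightarrow> 'a \<Rightarrow> nat"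
    by (simp add: cancel_2cycles_def)
  have loop: "arr Q m m = 0"
    using assms by (simp add: decorated_quiver_def)
  have "sarr (mutate k m Q) x y =
      int (reverse_at m (arr Q) x y) - int (reverse_at m (arr Q) y x)
      + (int (path_arrows m k (arr Q) x y) - int (path_arrows m k (arr Q) y x))"
    unfolding sarr_def mutate_def by (simp add: cancel)
  moreover have "int (path_arrows m k (arr Q) x y) - int (path_arrows m k (arr Q) y x) =
      k * (int (arr Q x m) * int (arr Q m y) - int (arr Q y m) * int (arr Q m x))"
    by (cases "k \<ge> 0") (simp_all add: path_arrows_def algebra_simps)
  ultimately show ?thesis
    using loop by (auto simp: reverse_at_def sarr_def)
qed

text \<open>A new arrow at \<open>m\<close> would need a loop at \<open>m\<close>, so only the
  reversal acts there.\<close>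

lemma arr_mutate_at:
  assumes "decorated_quiver Q"
  shows "arr (mutate k m Q) m y = arr Q y m" "arr (mutate k m Q) y m = arr Q m y"
proof -
  have "arr Q m m = 0" "arr Q m y = 0 \<or> arr Q y m = 0"
    using assms by (auto simp: decorated_quiver_def)
  then show "arr (mutate k m Q) m y = arr Q y m" "arr (mutate k m Q) y m = arr Q m y"
    by (auto simp: mutate_def cancel_2cycles_def reverse_at_def path_arrows_def)
qed

lemma verts_mutate [simp]: "verts (mutate k m Q) = verts Q"
  by (simp add: mutate_def)

lemma label_mutate:
  "label (mutate k m Q) = (label Q)(m := (k * diameter Q m - wlab Q m, diameter Q m - llab Q m))"
  by (simp add: mutate_def)

lemma wlab_mutate: "wlab (mutate k m Q) v = (if v = m then k * diameter Q m - wlab Q m else wlab Q v)"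
  by (simp add: wlab_def label_mutate)

lemma llab_mutate: "llab (mutate k m Q) v = (if v = m then diameter Q m - llab Q m else llab Q v)"
  by (simp add: llab_def label_mutate)

lemma decorated_quiver_mutate:
  assumes "decorated_quiver Q" "m \<in> verts Q"
  shows "decorated_quiver (mutate k m Q)"
proof -
  have supp: "x \<in> verts Q \<and> y \<in> verts Q" if "arr Q x y \<noteq> 0" for x y
    using assms(1) that unfolding decorated_quiver_def by blast
  have "x \<in> verts Q \<and> y \<in> verts Q" if "arr (mutate k m Q) x y \<noteq> 0" for x y
  proof -
    from that have "reverse_at m (arr Q) x y + path_arrows m k (arr Q) x y \<noteq> 0"
      unfolding mutate_def cancel_2cycles_def by (auto simp del: add_is_0)
    then have "arr Q x y \<noteq> 0 \<or> arr Q y x \<noteq> 0 \<or> (arr Q x m \<noteq> 0 \<and> arr Q m y \<noteq> 0)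
        \<or> (arr Q y m \<noteq> 0 \<and> arr Q m x \<noteq> 0)"
      by (auto simp: reverse_at_def path_arrows_def split: if_splits)
    then show ?thesis using supp by blast
  qed
  moreover have "label (mutate k m Q) \<in> extensional (verts Q)"
    using assms by (auto simp: label_mutate decorated_quiver_def extensional_def)
  ultimately show ?thesis
    \<comment> \<open>Truncated subtraction yields no loops and makes one of any two opposite counts
      zero.\<close>
    using assms unfolding decorated_quiver_def
    by (auto simp: mutate_def cancel_2cycles_def)
qed

lemma balanced_mutate:
  assumes "balanced Q" "m \<in> verts Q"
  shows "balanced (mutate k m Q)"
proof -
  have dec: "decorated_quiver Q" and fin: "finite (verts Q)"
    using assms by (auto simp: balanced_def decorated_quiver_def)
  have zero: "(\<Sum>v\<in>verts Q. wlab Q v * sarr Q x v) = 0" if "x \<in> verts Q" for x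
    using assms(1) that by (simp add: balanced_iff_sum_sarr)
  have loop: "arr Q m m = 0"
    using dec by (simp add: decorated_quiver_def)
  have "(\<Sum>v\<in>verts Q. wlab (mutate k m Q) v * sarr (mutate k m Q) x v) = 0" if x: "x \<in> verts Q" for x
  proof (cases "x = m")
    case True
    \<comment> \<open>The new weight of \<open>m\<close> is multiplied by the loop count zero, so
      the sum only changes sign.\<close>
    have "(\<Sum>v\<in>verts Q. wlab (mutate k m Q) v * sarr (mutate k m Q) x v)
        = (\<Sum>v\<in>verts Q. - (wlab Q v * sarr Q m v))"
      by (rule sum.cong) (auto simp: True sarr_mutate[OF dec] wlab_mutate sarr_def[of Q] loop
          right_diff_distrib)
    then show ?thesis using zero[OF assms(2)] by (simp add: sum_negf)
  next
    case False
    \<comment> \<open>The last summand collects the change of weight at \<open>v = m\<close>; the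
      two before it come from the new arrows.\<close>
    have "(\<Sum>v\<in>verts Q. wlab (mutate k m Q) v * sarr (mutate k m Q) x v)
        = (\<Sum>v\<in>verts Q. wlab Q v * sarr Q x v
             + k * int (arr Q x m) * (wlab Q v * int (arr Q m v))
             - k * int (arr Q m x) * (wlab Q v * int (arr Q v m))
             - (if v = m then k * diameter Q m * sarr Q x m else 0))"
      using False
      by (intro sum.cong) (auto simp: sarr_mutate[OF dec] wlab_mutate loop algebra_simps)
    also have "\<dots> = k * int (arr Q x m) * diameter Q m - k * int (arr Q m x) * diameter Q m
        - k * diameter Q m * sarr Q x m"
      \<comment> \<open>Balance at \<open>m\<close> turns both sums over paths through
        \<open>m\<close> into multiples of the same diameter.\<close>
      unfolding sum.distrib sum_subtractf sum_distrib_left[symmetric] zero[OF x]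
        diameter_out[OF dec, symmetric] diameter_in[OF assms, symmetric]
      using fin assms(2) by simp
    also have "\<dots> = 0"
      by (simp add: sarr_def algebra_simps)
    finally show ?thesis .
  qed
  then show ?thesis
    using decorated_quiver_mutate[OF dec assms(2)] by (simp add: balanced_iff_sum_sarr)
qed

section \<open>Two mutations at the same vertex\<close>

lemma diameter_mutate:
  assumes "balanced Q" "m \<in> verts Q"
  shows "diameter (mutate k m Q) m = diameter Q m"
proof -
  have dec: "decorated_quiver Q" and loop: "arr Q m m = 0"
    using assms by (auto simp: balanced_def decorated_quiver_def)
  show ?thesis
    \<comment> \<open>Reversal turns the new out-sum at \<open>m\<close> into the old
      in-sum.\<close>
    unfolding diameter_out[OF decorated_quiver_mutate[OF dec assms(2)]] diameter_in[OF assms]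
    by (rule sum.cong) (auto simp: arr_mutate_at[OF dec] wlab_mutate loop)
qed

lemma
  assumes "balanced Q" "m \<in> verts Q"
  shows mutate_mutate: "mutate t m (mutate s m Q) = mutate 0 m (mutate (s - t) m Q)"
    and mutate_0_0: "mutate 0 m (mutate 0 m Q) = Q"
proof -
  have dec: "decorated_quiver Q"
    using assms by (simp add: balanced_def)
  have dec1: "decorated_quiver (mutate k m Q)" for k
    using decorated_quiver_mutate[OF dec assms(2)] .
  have dec2: "decorated_quiver (mutate l m (mutate k m Q))" for k l
    using decorated_quiver_mutate[OF dec1] assms(2) by simp
  have lab: "label (mutate l m (mutate k m Q))
      = (label Q)(m := (wlab Q m - (k - l) * diameter Q m, llab Q m))" for k l
    by (simp add: label_mutate diameter_mutate[OF assms] wlab_mutate llab_mutate algebra_simps)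
  \<comment> \<open>The second mutation sees the arrows at \<open>m\<close> reversed, so its path
    term enters with the opposite sign. Labels and arrows thus depend on \<open>k\<close> and
    \<open>l\<close> only through \<open>k - l\<close>.\<close>
  have arrows: "sarr (mutate l m (mutate k m Q)) x y =
    (if x = m \<or> y = m then sarr Q x y
     else sarr Q x y
       + (k - l) * (int (arr Q x m) * int (arr Q m y) - int (arr Q y m) * int (arr Q m x)))" for k l x y
    by (simp add: sarr_mutate[OF dec1] sarr_mutate[OF dec] arr_mutate_at[OF dec] algebra_simps)
  show "mutate t m (mutate s m Q) = mutate 0 m (mutate (s - t) m Q)"
    by (rule decorated_quiver_eqI[OF dec2 dec2]) (simp_all add: lab arrows)
  show "mutate 0 m (mutate 0 m Q) = Q"
    by (rule decorated_quiver_eqI[OF dec2 dec])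
      (simp_all add: lab arrows wlab_def llab_def)
qed

section \<open>Relations between the functions \<open>mut k\<close>\<close>

lemma mut_PiE: "mut k \<in> balanced_pairs \<rightarrow>\<^sub>E balanced_pairs"
  by (auto simp: mut_def balanced_pairs_def balanced_mutate)

lemma mut_mut: "compose balanced_pairs (mut t) (mut s) = compose balanced_pairs (mut 0) (mut (s - t))"
  by (auto simp: compose_def mut_def balanced_pairs_def balanced_mutate mutate_mutate[of _ _ t s]
      intro!: restrict_ext)

lemma mut_0_0: "compose balanced_pairs (mut 0) (mut 0) = (\<lambda>p\<in>balanced_pairs. p)"
  by (auto simp: compose_def mut_def balanced_pairs_def balanced_mutate mutate_0_0
      intro!: restrict_ext)

lemma mut_self_inverse: "compose balanced_pairs (mut k) (mut k) = (\<lambda>p\<in>balanced_pairs. p)"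
  using mut_mut[of k k] by (simp add: mut_0_0)

section \<open>The group of finite compositions\<close>

lemma mut_compositions_PiE: "f \<in> mut_compositions \<Longrightarrow> f \<in> balanced_pairs \<rightarrow>\<^sub>E balanced_pairs"
proof (induction rule: mut_compositions.induct)
  case (single k)
  show ?case by (rule mut_PiE)
next
  case (comp f k)
  then show ?case using mut_PiE[of k] by (auto simp: compose_def)
qed

text \<open>\<open>compose\<close> restricts to \<open>balanced_pairs\<close>, so associativity
  relies on the innermost function mapping this set into itself.\<close>

lemma compose_assoc_mut_compositions:
  assumes "f \<in> mut_compositions"
  shows "compose balanced_pairs (compose balanced_pairs h g) f
       = compose balanced_pairs h (compose balanced_pairs g f)"
  using mut_compositions_PiE[OF assms] by (intro compose_assoc[symmetric]) auto

lemma compose_mut_compositions: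
  assumes "f \<in> mut_compositions" "g \<in> mut_compositions"
  shows "compose balanced_pairs f g \<in> mut_compositions"
  using assms
  by (induction rule: mut_compositions.induct)
    (auto simp: compose_assoc_mut_compositions intro: mut_compositions.intros)

lemma id_in_mut_compositions: "(\<lambda>p\<in>balanced_pairs. p) \<in> mut_compositions"
  using mut_compositions.comp[OF mut_compositions.single, of 0 0] by (simp add: mut_0_0)

lemma compose_id_mut_compositions:
  assumes "f \<in> mut_compositions"
  shows "compose balanced_pairs (\<lambda>p\<in>balanced_pairs. p) f = f"
  using mut_compositions_PiE[OF assms] by (intro Id_compose) (auto simp: PiE_def)

lemma mut_compositions_left_inverse:
  assumes "f \<in> mut_compositions"
  shows "\<exists>g\<in>mut_compositions. compose balanced_pairs g f = (\<lambda>p\<in>balanced_pairs. p)"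
  using assms
proof (induction rule: mut_compositions.induct)
  case (single k)
  show ?case using mut_self_inverse mut_compositions.single by blast
next
  case (comp f k)
  then obtain g where g: "g \<in> mut_compositions"
    "compose balanced_pairs g f = (\<lambda>p\<in>balanced_pairs. p)" by blast
  \<comment> \<open>Since \<open>mut k\<close> is self-inverse, \<open>g\<close> after
    \<open>mut k\<close> is a left inverse of \<open>mut k\<close> after \<open>f\<close>.\<close>
  have "compose balanced_pairs (compose balanced_pairs g (mut k)) (compose balanced_pairs (mut k) f)
      = compose balanced_pairs g (compose balanced_pairs (compose balanced_pairs (mut k) (mut k)) f)"
    using comp.hyps by (simp add: compose_assoc_mut_compositions mut_compositions.intros)
  also have "\<dots> = (\<lambda>p\<in>balanced_pairs. p)"
    using comp.hyps by (simp add: mut_self_inverse compose_id_mut_compositions g)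
  finally show ?case
    using compose_mut_compositions[OF g(1) mut_compositions.single] by blast
qed

lemma group_mut_group: "group mut_group"
  by (rule groupI)
    (auto simp: mut_group_def compose_mut_compositions id_in_mut_compositions
      compose_assoc_mut_compositions compose_id_mut_compositions mut_compositions_left_inverse)

section \<open>Generation by \<open>mut 0\<close> and \<open>mut 1\<close>\<close>

lemma generate_mut_group:
  "generate mut_group {mut 0, mut 1} = carrier mut_group"
proof -
  let ?H = "generate mut_group {mut 0, mut 1}"
  have mult: "compose balanced_pairs f g \<in> ?H" if "f \<in> ?H" "g \<in> ?H" for f g
    using generate.eng[OF that] by (simp add: mut_group_def)
  have gens: "mut 0 \<in> ?H" "mut 1 \<in> ?H"
    by (auto intro: generate.incl)
  have cancel: "compose balanced_pairs (mut j) (compose balanced_pairs (mut j) (mut k)) = mut k" for j k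
    by (simp add: compose_assoc_mut_compositions[symmetric] mut_self_inverse
        compose_id_mut_compositions mut_compositions.single)
  \<comment> \<open>The relation for \<open>t = 1\<close> equates \<open>mut 1\<close> after
    \<open>mut k\<close> with \<open>mut 0\<close> after \<open>mut (k - 1)\<close>; composing with
    the self-inverse \<open>mut 0\<close> isolates \<open>mut (k - 1)\<close>. For
    \<open>up\<close>, shift \<open>k\<close> by one and cancel \<open>mut 1\<close>
    instead.\<close>
  have down: "mut (k - 1) = compose balanced_pairs (mut 0) (compose balanced_pairs (mut 1) (mut k))" for k
    by (simp add: mut_mut[of 1 k] cancel)
  have up: "mut (k + 1) = compose balanced_pairs (mut 1) (compose balanced_pairs (mut 0) (mut k))" for k
    by (simp add: mut_mut[of 1 "k + 1", simplified, symmetric] cancel)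
  have mut_H: "mut k \<in> ?H" for k
    \<comment> \<open>The induction runs in both directions from 0.\<close>
    by (induction k rule: int_induct[where k = 0]) (simp_all only: up down mult gens)
  have "f \<in> ?H" if "f \<in> mut_compositions" for f
    using that by induction (auto intro: mut_H mult)
  moreover have "?H \<subseteq> carrier mut_group"
    by (intro group.generate_incl group_mut_group) (auto simp: mut_group_def mut_compositions.single)
  ultimately show ?thesis by (auto simp: mut_group_def)
qed

theorem proposition6p9:
  shows
    "(\<forall>(Q :: 'v dquiver) m k. balanced Q \<and> m \<in> verts Q \<longrightarrow> balanced (mutate k m Q)) \<and>
     (\<forall>k. mut k \<in> (balanced_pairs :: ('v dquiver \<times> 'v) set) \<rightarrow>\<^sub>E balanced_pairs) \<and>
     compose (balanced_pairs :: ('v dquiver \<times> 'v) set) (mut 0) (mut 0) = (\<lambda>p\<in>balanced_pairs. p) \<and>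
     (\<forall>s t. compose (balanced_pairs :: ('v dquiver \<times> 'v) set) (mut t) (mut s)
              = compose balanced_pairs (mut 0) (mut (s - t))) \<and>
     (\<forall>k. compose (balanced_pairs :: ('v dquiver \<times> 'v) set) (mut k) (mut k)
              = (\<lambda>p\<in>balanced_pairs. p)) \<and>
     group (mut_group :: ('v dquiver \<times> 'v \<Rightarrow> 'v dquiver \<times> 'v) monoid) \<and>
     generate (mut_group :: ('v dquiver \<times> 'v \<Rightarrow> 'v dquiver \<times> 'v) monoid) {mut 0, mut 1}
       = carrier mut_group"
  by (intro conjI allI impI)
    (auto simp only: balanced_mutate mut_PiE mut_0_0 mut_self_inverse group_mut_group
      generate_mut_group intro: mut_mut)

end
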